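(* Let $\mathcal{C}:\mathcal{I}_{n,h,b}\to\{0,1\}$ be the classifier with $\mathcal{C}(I)=0$ if $\sum_{x=1}^n\sum_{y=1}^n\sum_{a=1}^h I_{x,y,a}<n^2h/2$ and $\mathcal{C}(I)=1$ otherwise. Then there exists an interesting class $C$ induced by $\mathcal{C}$ such that for all $c>0$: 1. $C$ is $(1-4c)$-robust to $L^p$-perturbations of size $c\sqrt{h}\,n-2$ for all $p\le 1$. 2. $C$ is $(1-4c)$-robust to $L^p$-perturbations of size $\dfrac{(c\sqrt{h}\,n-2)^{1/p}}{2^b-1}$ for all $p\ge2$.
   Context: For integers $n,h,b\ge1$, $\mathcal{I}_{n,h,b}$ is the finite set of all real tensors of shape $(n,n,h)$ each of whose entries lies in the set of $2^b$ equally spaced values $\{x/(2^b-1): x=0,1,\dots,2^b-1\}\subset[0,1]$ ("images"). Throughout, $p$ is a non-negative integer. For a tensor $A$ and $p\ge1$, $\|A\|_p$ is the $p$th root of the sum of the $p$th powers of the absolute values of the entries of $A$; $\|A\|_0$ is the number of nonzero entries of $A$. A classifier is a function $\mathcal{C}:\mathcal{I}_{n,h,b}\to\mathcal{Y}$ with $\mathcal{Y}$ a finite set of labels; the classes induced by $\mathcal{C}$ are the preimages $\mathcal{C}^{-1}(y)$, $y\in\mathcal{Y}$. A class is interesting if it is nonempty and contains no more than half of the elements of $\mathcal{I}_{n,h,b}$. An image $I$ is robust to $L^p$-perturbations of size $d$ if for all $I'\in\mathcal{I}_{n,h,b}$, $\|I-I'\|_p\le d$ implies $\mathcal{C}(I)=\mathcal{C}(I')$.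 A class $C$ is $r$-robust to $L^p$-perturbations of size $d$ if $C$ is nonempty and the number of images $I\in C$ that are robust to $L^p$-perturbations of size $d$ is at least $r|C|$. *)

theory Defs
  imports Complex_Main "HOL-Library.FuncSet"
begin

text \<open>
  Tensors of shape \<open>(n, n, h)\<close> are functions on index triples, used only at indices in
  \<open>indices n h\<close>. Images are taken extensional (\<open>\<rightarrow>\<^sub>E\<close>), so that distinct functions are distinct
  tensors and cardinalities of sets of images are the intended ones.
\<close>

type_synonym tensor = "nat \<times> nat \<times> nat \<Rightarrow> real"

definition indices :: "nat \<Rightarrow> nat \<Rightarrow> (nat \<times> nat \<times> nat) set" where
  "indices n h = {1..n} \<times> {1..n} \<times> {1..h}"

definition pixel_values :: "nat \<Rightarrow> real set" where
  "pixel_values b = {real x / (2 ^ b - 1) | x :: nat. x \<le> 2 ^ b - 1}"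

definition images :: "nat \<Rightarrow> nat \<Rightarrow> nat \<Rightarrow> tensor set" where
  "images n h b = indices n h \<rightarrow>\<^sub>E pixel_values b"

definition tensor_norm :: "nat \<Rightarrow> nat \<Rightarrow> nat \<Rightarrow> tensor \<Rightarrow> real" where
  "tensor_norm n h p A =
     (if p = 0 then real (card {i \<in> indices n h. A i \<noteq> 0})
      else root p (\<Sum>i\<in>indices n h. \<bar>A i\<bar> ^ p))"

definition classifier :: "nat \<Rightarrow> nat \<Rightarrow> nat \<Rightarrow> 'y set \<Rightarrow> (tensor \<Rightarrow> 'y) \<Rightarrow> bool" where
  "classifier n h b Y f \<longleftrightarrow> finite Y \<and> f \<in> images n h b \<rightarrow> Y"

definition induced_classes ::
    "nat \<Rightarrow> nat \<Rightarrow> nat \<Rightarrow> 'y set \<Rightarrow> (tensor \<Rightarrow> 'y) \<Rightarrow> tensor set set" where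
  "induced_classes n h b Y f = {{I \<in> images n h b. f I = y} | y. y \<in> Y}"

definition interesting :: "nat \<Rightarrow> nat \<Rightarrow> nat \<Rightarrow> tensor set \<Rightarrow> bool" where
  "interesting n h b C \<longleftrightarrow> C \<noteq> {} \<and> real (card C) \<le> real (card (images n h b)) / 2"

text \<open>
  The size \<open>d\<close> may be negative, in which case robustness holds vacuously. Since \<open>root p\<close> with
  \<open>p \<ge> 1\<close> is negative on negative arguments, a size obtained as \<open>root p d\<close> is then negative as well.
\<close>

definition robust_image ::
    "nat \<Rightarrow> nat \<Rightarrow> nat \<Rightarrow> (tensor \<Rightarrow> 'y) \<Rightarrow> nat \<Rightarrow> real \<Rightarrow> tensor \<Rightarrow> bool" where
  "robust_image n h b f p d I \<longleftrightarrow>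
     (\<forall>I'\<in>images n h b. tensor_norm n h p (\<lambda>i. I i - I' i) \<le> d \<longrightarrow> f I = f I')"

definition robust_class ::
    "nat \<Rightarrow> nat \<Rightarrow> nat \<Rightarrow> (tensor \<Rightarrow> 'y) \<Rightarrow> real \<Rightarrow> nat \<Rightarrow> real \<Rightarrow> tensor set \<Rightarrow> bool" where
  "robust_class n h b f r p d C \<longleftrightarrow>
     C \<noteq> {} \<and> real (card {I \<in> C. robust_image n h b f p d I}) \<ge> r * real (card C)"

definition brightness_classifier :: "nat \<Rightarrow> nat \<Rightarrow> tensor \<Rightarrow> nat" where
  "brightness_classifier n h I =
     (if (\<Sum>x=1..n. \<Sum>y=1..n. \<Sum>a=1..h. I (x, y, a)) < real (n\<^sup>2 * h) / 2 then 0 else 1)"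

lemma classifier_brightness: "classifier n h b {0, 1} (brightness_classifier n h)"
  by (simp add: classifier_def brightness_classifier_def)

lemma finite_images: "finite (images n h b)"
proof -
  have "pixel_values b = (\<lambda>x. real x / (2 ^ b - 1)) ` {..2 ^ b - 1}"
    by (auto simp: pixel_values_def)
  then show ?thesis
    by (simp add: images_def indices_def finite_PiE)
qed

end

theory Submission
  imports Defs
begin

text \<open>
  Write a pixel as \<open>(y + L e) / (2 ^ b - 1)\<close> with \<open>L = 2 ^ (b - 1)\<close>, \<open>y < L\<close> and top bit
  \<open>e \<in> {0, 1}\<close>. For fixed \<open>y\<close>, a half-open window of brightness of length \<open>w = L / (2 ^ b - 1)\<close>
  determines the number of top bits that are set. So by the Littlewood--Offord argument at
  most \<open>L ^ m\<close> times the central binomial coefficient of \<open>m = n\<^sup>2 h\<close>, hence at most a fraction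
  \<open>1 / sqrt m\<close> of all images, have their brightness in a given window. The class of dark images is
  interesting by the symmetry \<open>I \<mapsto> 1 - I\<close>. Its non-robust images have brightness in
  \<open>{m/2 - d..<m/2}\<close> with \<open>d = c sqrt m - 2\<close>, which is covered by \<open>2 d + 1\<close> windows because
  \<open>w \<ge> 1/2\<close>.
\<close>

subsection \<open>Central binomial coefficients\<close>

text \<open>Absorption applied twice, with symmetry of the odd row in between, gives the ratio of
  consecutive central binomials in division-free form.\<close>

lemma Suc_times_central_binomial:
  "Suc k * (2 * Suc k choose Suc k) = 2 * (2 * k + 1) * (2 * k choose k)"
proof -
  have "Suc k * (2 * Suc k choose Suc k) = 2 * Suc k * (Suc (2 * k) choose k)"
    using Suc_times_binomial_eq[of "Suc (2 * k)" k] by simp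
  also have "Suc (2 * k) choose k = Suc (2 * k) choose Suc k"
    using binomial_symmetric[of k "Suc (2 * k)"] by simp
  also have "2 * Suc k * (Suc (2 * k) choose Suc k) = 2 * (Suc k * (Suc (2 * k) choose Suc k))"
    by simp
  also have "\<dots> = 2 * (2 * k + 1) * (2 * k choose k)"
    using Suc_times_binomial_eq[of "2 * k" k] by (simp add: algebra_simps)
  finally show ?thesis .
qed

text \<open>The weight \<open>2 * k + 1\<close> makes the induction close: each step multiplies the
  left side by 4 (2k+3)(2k+1) / (k+1)^2, which is below 16 because (2k+3)(2k+1) = 4 (k+1)^2 -
  1.\<close>

lemma central_binomial_upper_bound: "(2 * k + 1) * (2 * k choose k)\<^sup>2 \<le> 16 ^ k"
proof (induction k)
  case 0
  then show ?case by simp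
next
  case (Suc k)
  let ?B = "2 * k choose k"
  \<comment> \<open>The factor \<open>(Suc k)\<^sup>2\<close> lets the recurrence apply within the
    natural numbers; it is cancelled at the end.\<close>
  have "(Suc k)\<^sup>2 * ((2 * Suc k + 1) * (2 * Suc k choose Suc k)\<^sup>2)
      = (2 * k + 3) * (Suc k * (2 * Suc k choose Suc k))\<^sup>2"
    by (simp only: power_mult_distrib) (simp add: algebra_simps del: binomial_Suc_Suc)
  also have "\<dots> = (2 * k + 3) * (2 * (2 * k + 1) * ?B)\<^sup>2"
    by (simp only: Suc_times_central_binomial)
  also have "\<dots> = 4 * ((2 * k + 3) * (2 * k + 1)) * ((2 * k + 1) * ?B\<^sup>2)"
    by (simp add: power2_eq_square algebra_simps)
  also have "\<dots> \<le> 4 * (4 * (Suc k)\<^sup>2) * 16 ^ k"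
    by (rule mult_mono[OF _ Suc.IH]) (auto simp: power2_eq_square algebra_simps)
  also have "\<dots> = (Suc k)\<^sup>2 * 16 ^ Suc k"
    by simp
  finally show ?case
    by (simp del: binomial_Suc_Suc power_Suc)
qed

text \<open>Even rows are central already. In an odd row the two middle entries are equal and add up
  to the next central binomial, so the central bound applies one row further down.\<close>

lemma middle_binomial_upper_bound: "m * (m choose (m div 2))\<^sup>2 \<le> 4 ^ m"
proof (cases "even m")
  case True
  then obtain k where m: "m = 2 * k" by (elim evenE)
  have "m * (m choose (m div 2))\<^sup>2 \<le> (2 * k + 1) * (2 * k choose k)\<^sup>2"
    by (simp add: m)
  also have "\<dots> \<le> 16 ^ k" by (rule central_binomial_upper_bound)
  also have "(16::nat) ^ k = 4 ^ m" by (simp add: m power_mult)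
  finally show ?thesis .
next
  case False
  then obtain k where m: "m = 2 * k + 1" by (elim oddE)
  have sym: "Suc (2 * k) choose Suc k = Suc (2 * k) choose k"
    using binomial_symmetric[of k "Suc (2 * k)"] by simp
  have "2 * Suc k choose Suc k = (Suc (2 * k) choose k) + (Suc (2 * k) choose Suc k)"
    by simp
  then have double: "2 * Suc k choose Suc k = 2 * (m choose (m div 2))"
    using sym by (simp add: m del: binomial_Suc_Suc)
  have "4 * (m * (m choose (m div 2))\<^sup>2) = m * (2 * Suc k choose Suc k)\<^sup>2"
    by (simp only: double) (simp add: power2_eq_square)
  also have "\<dots> \<le> (2 * Suc k + 1) * (2 * Suc k choose Suc k)\<^sup>2"
    by (rule mult_right_mono) (simp_all add: m)
  also have "\<dots> \<le> 16 ^ Suc k" by (rule central_binomial_upper_bound)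
  also have "(16::nat) ^ Suc k = 4 * 4 ^ m" by (simp add: m power_mult)
  finally show ?thesis by simp
qed

lemma sqrt_times_middle_binomial: "sqrt (real m) * real (m choose (m div 2)) \<le> 2 ^ m"
proof (rule power2_le_imp_le)
  have "real (m * (m choose (m div 2))\<^sup>2) \<le> real (4 ^ m)"
    by (simp only: of_nat_le_iff middle_binomial_upper_bound)
  moreover have "(4::real) ^ m = (2 ^ m)\<^sup>2"
    by (metis num_double numeral_times_numeral power2_eq_square power_mult_distrib)
  ultimately show "(sqrt (real m) * real (m choose (m div 2)))\<^sup>2 \<le> (2 ^ m)\<^sup>2"
    by (simp add: power_mult_distrib)
qed simp

subsection \<open>Images of given brightness\<close>

definition brightness :: "nat \<Rightarrow> nat \<Rightarrow> tensor \<Rightarrow> real" where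
  "brightness n h I = (\<Sum>i\<in>indices n h. I i)"

lemma finite_indices [simp]: "finite (indices n h)"
  by (simp add: indices_def)

lemma card_indices: "card (indices n h) = n\<^sup>2 * h"
  by (simp add: indices_def power2_eq_square)

lemma brightness_classifier_eq:
  "brightness_classifier n h I = (if brightness n h I < real (n\<^sup>2 * h) / 2 then 0 else 1)"
  by (simp add: brightness_classifier_def brightness_def indices_def sum.cartesian_product)

lemma pixel_denominator_pos: "b \<ge> 1 \<Longrightarrow> (2::real) ^ b - 1 > 0"
  using one_less_power[of "2::real" b] by simp

lemma pixel_values_eq: "pixel_values b = (\<lambda>x. real x / (2 ^ b - 1)) ` {..<2 ^ b}"
proof -
  have "x \<le> 2 ^ b - 1 \<longleftrightarrow> x < 2 ^ b" for x :: nat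
    using zero_less_power[of "2::nat" b] by linarith
  then show ?thesis
    by (auto simp: pixel_values_def)
qed

lemma card_pixel_values:
  assumes "b \<ge> 1"
  shows "card (pixel_values b) = 2 ^ b"
proof -
  define q :: real where "q = 2 ^ b - 1"
  have "q > 0" using pixel_denominator_pos[OF assms] by (simp add: q_def)
  then have "inj_on (\<lambda>x. real x / q) {..<2 ^ b}"
    by (simp add: inj_on_def)
  then show ?thesis
    by (simp add: pixel_values_eq q_def card_image)
qed

lemma card_images: "b \<ge> 1 \<Longrightarrow> card (images n h b) = (2 ^ b) ^ (n\<^sup>2 * h)"
  by (simp add: images_def card_PiE card_pixel_values card_indices)

lemma pixel_values_bounds: "b \<ge> 1 \<Longrightarrow> v \<in> pixel_values b \<Longrightarrow> 0 \<le> v \<and> v \<le> 1"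
proof -
  assume b: "b \<ge> 1" and "v \<in> pixel_values b"
  then obtain x :: nat where x: "x < 2 ^ b" "v = real x / (2 ^ b - 1)"
    by (auto simp: pixel_values_eq)
  then have "real (Suc x) \<le> 2 ^ b"
    by (metis Suc_leI of_nat_le_iff of_nat_numeral of_nat_power)
  then show ?thesis
    using pixel_denominator_pos[OF b] x by simp
qed

lemma pixel_values_reflect: "v \<in> pixel_values b \<Longrightarrow> b \<ge> 1 \<Longrightarrow> 1 - v \<in> pixel_values b"
proof -
  assume "v \<in> pixel_values b" and b: "b \<ge> 1"
  then obtain x :: nat where x: "x < 2 ^ b" "v = real x / (2 ^ b - 1)"
    by (auto simp: pixel_values_eq)
  then have "real (2 ^ b - 1 - x) = 2 ^ b - 1 - real x"
    by (simp add: of_nat_diff)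
  then have "1 - v = real (2 ^ b - 1 - x) / (2 ^ b - 1)"
    using pixel_denominator_pos[OF b] x by (simp add: field_simps)
  moreover have "2 ^ b - 1 - x \<in> {..<2 ^ b}"
    using x(1) by simp
  ultimately show ?thesis
    unfolding pixel_values_eq by (rule image_eqI)
qed

section \<open>Littlewood-Offord counting in windows of brightness\<close>

definition window :: "nat \<Rightarrow> real" where
  "window b = 2 ^ (b - 1) / (2 ^ b - 1)"

lemma window_ge_half:
  assumes "b \<ge> 1"
  shows "window b \<ge> 1 / 2"
proof -
  have "(2::real) ^ b = 2 * 2 ^ (b - 1)"
    using assms by (cases b) auto
  then show ?thesis
    using pixel_denominator_pos[OF assms] by (simp add: window_def field_simps)
qed

text \<open>The number of choices of low parts, times the largest number of sets of top bits that
  share one cardinality.\<close>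

definition window_bound :: "nat \<Rightarrow> nat \<Rightarrow> nat \<Rightarrow> nat" where
  "window_bound n h b = (2 ^ (b - 1)) ^ (n\<^sup>2 * h) * (n\<^sup>2 * h choose (n\<^sup>2 * h div 2))"

text \<open>With the low parts fixed, brightness depends on the top bits only through their number,
  in steps of exactly \<open>window b\<close>. A half-open interval of that length admits one number
  only, and the middle binomial bounds the sets of that size.\<close>

lemma card_window_le:
  assumes b: "b \<ge> 1"
  shows "card {I \<in> images n h b. a \<le> brightness n h I \<and> brightness n h I < a + window b}
           \<le> window_bound n h b"
proof -
  define L :: nat where "L = 2 ^ (b - 1)"
  define q :: real where "q = 2 ^ b - 1"
  define J where "J = indices n h"
  define m where "m = n\<^sup>2 * h"
  \<comment> \<open>Assembles an image from low parts \<open>Y\<close> and the set \<open>E\<close>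
    of pixels with top bit 1; the restriction to \<open>J\<close> makes it extensional.\<close>
  define join :: "(nat \<times> nat \<times> nat \<Rightarrow> nat) \<times> (nat \<times> nat \<times> nat) set \<Rightarrow> tensor"
    where "join = (\<lambda>(Y, E). \<lambda>i\<in>J. real (Y i + L * (if i \<in> E then 1 else 0)) / q)"
  define W where "W = {a..<a + window b}"
  define S where "S = (\<lambda>Y. {E \<in> Pow J. brightness n h (join (Y, E)) \<in> W})"
  have q: "q > 0" using pixel_denominator_pos[OF b] by (simp add: q_def)
  have L: "L > 0" and two_L: "2 ^ b = 2 * L"
    using b by (cases b; simp add: L_def)+
  have finJ: "finite J" and cardJ: "card J = m"
    by (simp_all add: J_def m_def card_indices)
  have bright: "brightness n h (join (Y, E)) * q = real (\<Sum>i\<in>J. Y i) + real L * real (card E)"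
    if "E \<subseteq> J" for Y E
  proof -
    have "brightness n h (join (Y, E)) * q
        = (\<Sum>i\<in>J. real (Y i) + real L * (if i \<in> E then 1 else 0))"
      using q unfolding brightness_def J_def[symmetric] sum_distrib_right
      by (intro sum.cong) (auto simp: join_def)
    also have "\<dots> = real (\<Sum>i\<in>J. Y i) + real L * (\<Sum>i\<in>J. if i \<in> E then 1 else 0)"
      by (simp add: sum.distrib sum_distrib_left)
    also have "(\<Sum>i\<in>J. if i \<in> E then 1 else 0) = real (card E)"
      using that finJ by (simp add: sum.If_cases Int_absorb1)
    finally show ?thesis .
  qed
  have card_S: "card (S Y) \<le> m choose (m div 2)" for Y
  proof (cases "S Y = {}")
    case False
    then obtain E\<^sub>0 where E\<^sub>0: "E\<^sub>0 \<in> S Y" by blast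
    have "card E = card E\<^sub>0" if E: "E \<in> S Y" for E
    proof -
      have wq: "window b * q = real L"
        using q by (simp add: window_def q_def L_def)
      have diff: "(brightness n h (join (Y, E)) - brightness n h (join (Y, E\<^sub>0))) * q
          = real L * (real (card E) - real (card E\<^sub>0))"
        using E E\<^sub>0 bright[of E Y] bright[of E\<^sub>0 Y] by (simp add: S_def algebra_simps)
      \<comment> \<open>The window is open on one side, so this is strict; scaled by
        \<open>q\<close>, it keeps the two cardinalities less than 1 apart.\<close>
      have "\<bar>brightness n h (join (Y, E)) - brightness n h (join (Y, E\<^sub>0))\<bar> < window b"
        using E E\<^sub>0 by (auto simp: S_def W_def)
      then have "\<bar>brightness n h (join (Y, E)) - brightness n h (join (Y, E\<^sub>0))\<bar> * q < real L"
        using q wq mult_strict_right_mono by metis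
      then have "real L * \<bar>real (card E) - real (card E\<^sub>0)\<bar> < real L * 1"
        using q L diff by (metis abs_mult abs_of_nat abs_of_pos mult.right_neutral)
      then have "\<bar>real (card E) - real (card E\<^sub>0)\<bar> < 1"
        using L by (simp only: mult_less_cancel_left_pos of_nat_0_less_iff)
      then show ?thesis by linarith
    qed
    then have "S Y \<subseteq> {E. E \<subseteq> J \<and> card E = card E\<^sub>0}"
      by (auto simp: S_def)
    then have "card (S Y) \<le> card {E. E \<subseteq> J \<and> card E = card E\<^sub>0}"
      using finJ by (intro card_mono) auto
    also have "\<dots> = m choose card E\<^sub>0"
      using n_subsets[OF finJ] cardJ by simp
    also have "\<dots> \<le> m choose (m div 2)"
      by (rule binomial_maximum)
    finally show ?thesis .
  qed simp
  let ?P = "J \<rightarrow>\<^sub>E {..<L}"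
  have finP: "finite ?P" by (intro finite_PiE finJ) simp
  have finS: "finite (S Y)" for Y using finJ by (simp add: S_def)
  \<comment> \<open>For an upper bound it suffices that every image in the window arises from some
    pair. The pair comes from division by \<open>L\<close>, whose quotient is 0 or 1 because pixel
    numerators are below \<open>2 * L\<close>.\<close>
  have "{I \<in> images n h b. brightness n h I \<in> W} \<subseteq> join ` (SIGMA Y:?P. S Y)"
  proof safe
    fix I assume I: "I \<in> images n h b" and bI: "brightness n h I \<in> W"
    have "\<exists>x<2 ^ b. I i = real x / q" if "i \<in> J" for i
      using I that by (auto simp: images_def J_def pixel_values_eq q_def)
    then obtain x where x: "\<And>i. i \<in> J \<Longrightarrow> x i < (2::nat) ^ b \<and> I i = real (x i) / q"
      by metis
    define Y where "Y = (\<lambda>i\<in>J. x i mod L)"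
    define E where "E = {i \<in> J. x i div L = 1}"
    have split: "Y i + L * (if i \<in> E then 1 else 0) = x i" if "i \<in> J" for i
    proof -
      have "x i div L < 2"
        using x[OF that] two_L by (simp add: less_mult_imp_div_less)
      then have "x i div L = (if i \<in> E then 1 else 0)"
        using that by (auto simp: E_def)
      then show ?thesis
        using that mod_mult_div_eq[of "x i" L] by (simp add: Y_def)
    qed
    have I_eq: "I = join (Y, E)"
    proof
      fix i
      show "I i = join (Y, E) i"
      proof (cases "i \<in> J")
        case True
        then show ?thesis using split[OF True] x[OF True] by (simp only: join_def prod.case restrict_apply' if_True)
      next
        case False
        then have "I i = undefined"
          using I unfolding images_def J_def by (rule PiE_arb[rotated])
        then show ?thesis
          using False by (simp add: join_def)
      qed
    qed
    have "Y \<in> ?P" using L by (auto simp: Y_def)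
    moreover have "E \<in> S Y" using bI unfolding I_eq by (simp add: S_def) (simp add: E_def)
    ultimately show "I \<in> join ` (SIGMA Y:?P. S Y)"
      unfolding I_eq by blast
  qed
  then have "card {I \<in> images n h b. brightness n h I \<in> W} \<le> card (SIGMA Y:?P. S Y)"
    using finP finS by (intro surj_card_le) auto
  also have "\<dots> = (\<Sum>Y\<in>?P. card (S Y))"
    using finP finS by (simp add: card_SigmaI)
  also have "\<dots> \<le> card ?P * (m choose (m div 2))"
    using sum_bounded_above[of ?P "\<lambda>Y. card (S Y)", OF card_S] by simp
  also have "card ?P = L ^ m"
    using finJ by (simp add: card_PiE cardJ)
  finally show ?thesis
    by (simp add: W_def window_bound_def L_def m_def)
qed

text \<open>The interval of length \<open>K * window b\<close> just below \<open>a\<close> is tiled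
  by \<open>K\<close> adjacent windows.\<close>

lemma card_windows_le:
  assumes "b \<ge> 1"
  shows "card {I \<in> images n h b. a - real K * window b \<le> brightness n h I \<and> brightness n h I < a}
           \<le> K * window_bound n h b"
proof (induction K)
  case 0
  have "{I \<in> images n h b. a \<le> brightness n h I \<and> brightness n h I < a} = {}"
    by auto
  then show ?case by (simp only: of_nat_0 mult_zero_left diff_zero card.empty)
next
  case (Suc K)
  let ?w = "window b"
  let ?a' = "a - real (Suc K) * ?w"
  have "{I \<in> images n h b. ?a' \<le> brightness n h I \<and> brightness n h I < a}
      \<subseteq> {I \<in> images n h b. ?a' \<le> brightness n h I \<and> brightness n h I < ?a' + ?w}
       \<union> {I \<in> images n h b. a - real K * ?w \<le> brightness n h I \<and> brightness n h I < a}"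
    by (auto simp: algebra_simps)
  then have "card {I \<in> images n h b. ?a' \<le> brightness n h I \<and> brightness n h I < a}
      \<le> card ({I \<in> images n h b. ?a' \<le> brightness n h I \<and> brightness n h I < ?a' + ?w}
       \<union> {I \<in> images n h b. a - real K * ?w \<le> brightness n h I \<and> brightness n h I < a})"
    by (rule card_mono[rotated]) (simp add: finite_images)
  also have "\<dots> \<le> window_bound n h b + K * window_bound n h b"
    using card_Un_le add_mono[OF card_window_le[OF assms, where a = ?a'] Suc.IH]
    by (rule order_trans)
  finally show ?case by simp
qed

text \<open>Since 2^b is twice 2^(b-1), the low parts contribute the same factor on both sides and
  the middle binomial is compared with 2^m. Hence a window holds at most a fraction 1 / sqrt m of
  all images.\<close>

lemma sqrt_times_window_bound:
  assumes "b \<ge> 1"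
  shows "sqrt (real (n\<^sup>2 * h)) * real (window_bound n h b) \<le> real (card (images n h b))"
proof -
  let ?m = "n\<^sup>2 * h"
  have "(2::real) ^ b = 2 ^ (b - 1) * 2"
    using assms by (cases b) auto
  then have "real (card (images n h b)) = (2 ^ (b - 1)) ^ ?m * 2 ^ ?m"
    by (simp only: card_images[OF assms] of_nat_power of_nat_numeral power_mult_distrib)
  then show ?thesis
    using mult_left_mono[OF sqrt_times_middle_binomial[of ?m], of "(2 ^ (b - 1)) ^ ?m"]
    by (simp add: window_bound_def mult_ac)
qed

subsection \<open>The class of dark images\<close>

text \<open>The class with label 0. Images of exactly half brightness fall into the other class, so
  this one never exceeds half of all images.\<close>

definition dark :: "nat \<Rightarrow> nat \<Rightarrow> nat \<Rightarrow> tensor set" where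
  "dark n h b = {I \<in> images n h b. brightness n h I < real (n\<^sup>2 * h) / 2}"

lemma finite_dark: "finite (dark n h b)"
  by (simp add: dark_def finite_images)

lemma dark_induced: "dark n h b \<in> induced_classes n h b {0, 1} (brightness_classifier n h)"
proof -
  have "dark n h b = {I \<in> images n h b. brightness_classifier n h I = 0}"
    by (auto simp: dark_def brightness_classifier_eq)
  then show ?thesis
    unfolding induced_classes_def by blast
qed

lemma dark_nonempty:
  assumes "n \<ge> 1" and "h \<ge> 1"
  shows "dark n h b \<noteq> {}"
proof -
  have "0 \<in> pixel_values b"
    unfolding pixel_values_eq by force
  then have "(\<lambda>i\<in>indices n h. 0) \<in> dark n h b"
    using assms by (auto simp: dark_def images_def brightness_def)
  then show ?thesis by blast
qed

lemma card_bright_eq_card_dark: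
  assumes b: "b \<ge> 1"
  shows "card {I \<in> images n h b. brightness n h I > real (n\<^sup>2 * h) / 2} = card (dark n h b)"
proof (rule sym, rule bij_betw_same_card)
  \<comment> \<open>The restriction keeps the reflected tensor extensional, so that \<open>r\<close>
    is an involution on the images.\<close>
  define r where "r = (\<lambda>I::tensor. \<lambda>i\<in>indices n h. 1 - I i)"
  have r_image: "r I \<in> images n h b" if "I \<in> images n h b" for I
    using that pixel_values_reflect[OF _ b] by (auto simp: r_def images_def)
  have r_r: "r (r I) = I" if "I \<in> images n h b" for I
    using that by (auto simp: r_def images_def PiE_def extensional_def)
  have r_bright: "brightness n h (r I) = real (n\<^sup>2 * h) - brightness n h I" for I
    by (simp add: r_def brightness_def sum_subtractf card_indices)
  show "bij_betw r (dark n h b) {I \<in> images n h b. brightness n h I > real (n\<^sup>2 * h) / 2}"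
    by (rule bij_betw_byWitness[where f' = r]) (auto simp: dark_def r_r r_image r_bright mult.commute)
qed

lemma card_images_split:
  assumes "b \<ge> 1"
  shows "card (images n h b)
           = 2 * card (dark n h b) + card {I \<in> images n h b. brightness n h I = real (n\<^sup>2 * h) / 2}"
proof -
  let ?M = "{I \<in> images n h b. brightness n h I = real (n\<^sup>2 * h) / 2}"
  let ?U = "{I \<in> images n h b. brightness n h I > real (n\<^sup>2 * h) / 2}"
  have split: "images n h b = dark n h b \<union> (?M \<union> ?U)"
    by (auto simp: dark_def)
  have "card (dark n h b \<union> (?M \<union> ?U)) = card (dark n h b) + card (?M \<union> ?U)"
    by (rule card_Un_disjoint) (auto simp: dark_def finite_images)
  also have "card (?M \<union> ?U) = card ?M + card ?U"
    by (rule card_Un_disjoint) (auto simp: finite_images)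
  finally show ?thesis
    using card_bright_eq_card_dark[OF assms, of n h] arg_cong[OF split, of card] by linarith
qed

lemma dark_interesting:
  assumes "n \<ge> 1" and "h \<ge> 1" and "b \<ge> 1"
  shows "interesting n h b (dark n h b)"
proof -
  have "2 * real (card (dark n h b)) \<le> real (card (images n h b))"
    using card_images_split[OF assms(3), of n h] by linarith
  then show ?thesis
    using dark_nonempty[OF assms(1,2)] by (simp add: interesting_def)
qed

text \<open>The images of exactly half brightness fit into a single window. This turns a fraction of
  all images into a fraction of the dark class.\<close>

lemma card_images_le_dark:
  assumes "b \<ge> 1"
  shows "card (images n h b) \<le> 2 * card (dark n h b) + window_bound n h b"
proof -
  let ?a = "real (n\<^sup>2 * h) / 2"
  have "card {I \<in> images n h b. brightness n h I = ?a}
      \<le> card {I \<in> images n h b. ?a \<le> brightness n h I \<and> brightness n h I < ?a + window b}"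
    using window_ge_half[OF assms] by (intro card_mono) (auto simp: finite_images)
  also have "\<dots> \<le> window_bound n h b"
    by (rule card_window_le[OF assms])
  finally show ?thesis
    using card_images_split[OF assms, of n h] by linarith
qed

lemma card_below_threshold_le:
  assumes b: "b \<ge> 1" and c: "0 < c" "c \<le> 1 / 4"
    and d: "d = c * sqrt (real (n\<^sup>2 * h)) - 2"
  shows "real (card {I \<in> dark n h b. real (n\<^sup>2 * h) / 2 - d \<le> brightness n h I})
           \<le> 4 * c * real (card (dark n h b))"
proof (cases "d < 0")
  case True
  \<comment> \<open>For negative \<open>d\<close> the lower limit lies above the threshold that dark
    images stay below.\<close>
  then have "{I \<in> dark n h b. real (n\<^sup>2 * h) / 2 - d \<le> brightness n h I} = {}"
    by (auto simp: dark_def)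
  then show ?thesis
    using c by (simp only: card.empty) simp
next
  case False
  let ?m = "real (n\<^sup>2 * h)"
  define w where "w = window b"
  define B where "B = real (window_bound n h b)"
  \<comment> \<open>The number of windows that cover a strip of width \<open>d\<close>; as
    \<open>w\<close> is at least 1/2, it is at most 2d + 1.\<close>
  define K where "K = nat \<lceil>d / w\<rceil>"
  have w: "w \<ge> 1 / 2" using window_ge_half[OF b] by (simp add: w_def)
  have "d / w \<le> 2 * d"
    using w False mult_left_mono[of 1 "2 * w" d] by (simp add: field_simps)
  moreover have "d / w \<ge> 0" using w False by simp
  ultimately have K: "real K \<le> 2 * d + 1" "d / w \<le> real K"
    unfolding K_def by linarith+
  have dK: "d \<le> real K * w"
    using K(2) w by (simp add: field_simps)
  have "card {I \<in> dark n h b. ?m / 2 - d \<le> brightness n h I}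
      \<le> card {I \<in> images n h b. ?m / 2 - real K * w \<le> brightness n h I \<and> brightness n h I < ?m / 2}"
    using dK by (intro card_mono) (auto simp: dark_def finite_images)
  also have "\<dots> \<le> K * window_bound n h b"
    unfolding w_def by (rule card_windows_le[OF b])
  finally have "real (card {I \<in> dark n h b. ?m / 2 - d \<le> brightness n h I}) \<le> real K * B"
    by (simp add: B_def flip: of_nat_mult)
  also have "\<dots> \<le> (2 * d + 1) * B"
    using K(1) by (intro mult_right_mono) (simp_all add: B_def)
  also have "\<dots> = 2 * c * (sqrt ?m * B) - 3 * B"
    by (simp add: d algebra_simps)
  \<comment> \<open>The offset -2 in \<open>d\<close> leaves -3B, of which 2cB pays for the images
    of exactly half brightness.\<close>
  also have "\<dots> \<le> 2 * c * real (card (images n h b)) - 2 * c * B"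
  proof (rule diff_mono)
    show "2 * c * (sqrt ?m * B) \<le> 2 * c * real (card (images n h b))"
      using sqrt_times_window_bound[OF b, of n h] c by (intro mult_left_mono) (auto simp: B_def)
    show "2 * c * B \<le> 3 * B"
      using c by (intro mult_right_mono) (auto simp: B_def)
  qed
  also have "\<dots> = 2 * c * (real (card (images n h b)) - B)"
    by (simp add: algebra_simps)
  also have "\<dots> \<le> 2 * c * (2 * real (card (dark n h b)))"
    using card_images_le_dark[OF b, of n h] c by (intro mult_left_mono) (auto simp: B_def)
  finally show ?thesis by simp
qed

subsection \<open>Perturbations\<close>

lemma brightness_diff_le:
  "brightness n h I' - brightness n h I \<le> (\<Sum>i\<in>indices n h. \<bar>I i - I' i\<bar>)"
  unfolding brightness_def sum_subtractf[symmetric] by (rule sum_mono) linarith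

text \<open>Pixel values lie in [0, 1], so each differing entry contributes at most 1 to the sum of
  differences; for \<open>p = 1\<close> the norm is that sum.\<close>

lemma brightness_diff_le_norm_01:
  assumes b: "b \<ge> 1" and I: "I \<in> images n h b" "I' \<in> images n h b" and p: "p \<le> 1"
    and le: "tensor_norm n h p (\<lambda>i. I i - I' i) \<le> d"
  shows "brightness n h I' - brightness n h I \<le> d"
proof -
  have "(\<Sum>i\<in>indices n h. \<bar>I i - I' i\<bar>) \<le> tensor_norm n h p (\<lambda>i. I i - I' i)"
  proof (cases "p = 0")
    case True
    have "(\<Sum>i\<in>indices n h. \<bar>I i - I' i\<bar>) \<le> (\<Sum>i\<in>indices n h. if I i - I' i \<noteq> 0 then 1 else 0)"
    proof (rule sum_mono)
      fix i assume "i \<in> indices n h"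
      then have "I i \<in> pixel_values b" "I' i \<in> pixel_values b"
        using I by (auto simp: images_def)
      then show "\<bar>I i - I' i\<bar> \<le> (if I i - I' i \<noteq> 0 then 1 else 0)"
        using pixel_values_bounds[OF b, of "I i"] pixel_values_bounds[OF b, of "I' i"] by auto
    qed
    also have "\<dots> = real (card {i \<in> indices n h. I i - I' i \<noteq> 0})"
      by (subst sum.inter_filter[symmetric]) simp_all
    finally show ?thesis using True by (simp add: tensor_norm_def)
  next
    case False
    then have "p = 1" using p by simp
    then show ?thesis by (simp add: tensor_norm_def)
  qed
  then show ?thesis
    using brightness_diff_le[of n h I' I] le by linarith
qed

text \<open>
  The scaled differences \<open>(2 ^ b - 1) * \<bar>I i - I' i\<bar>\<close> are natural numbers, so they are bounded by
  their \<open>p\<close>th powers.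
\<close>
lemma brightness_diff_le_norm_ge2:
  assumes b: "b \<ge> 1" and I: "I \<in> images n h b" "I' \<in> images n h b" and p: "p \<ge> 2"
    and le: "tensor_norm n h p (\<lambda>i. I i - I' i) \<le> root p d / (2 ^ b - 1)"
  shows "brightness n h I' - brightness n h I \<le> d"
proof -
  define q :: real where "q = 2 ^ b - 1"
  define T where "T = (\<Sum>i\<in>indices n h. \<bar>I i - I' i\<bar> ^ p)"
  have "(2::real) ^ 1 \<le> 2 ^ b" using b by (intro power_increasing) auto
  then have q: "q \<ge> 1" by (simp add: q_def)
  have "q * root p T \<le> root p d"
    using le p q by (simp add: tensor_norm_def T_def q_def[symmetric] field_simps)
  moreover have "q * root p T = root p (q ^ p * T)"
    using p q by (simp add: real_root_mult real_root_power_cancel)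
  \<comment> \<open>\<open>root p\<close> is strictly increasing on all reals, so a negative
    \<open>d\<close> is covered as well.\<close>
  ultimately have qT: "q ^ p * T \<le> d"
    using p by simp
  have "q * (\<Sum>i\<in>indices n h. \<bar>I i - I' i\<bar>) \<le> q ^ p * T"
    unfolding T_def sum_distrib_left
  proof (rule sum_mono)
    fix i assume "i \<in> indices n h"
    then have "I i \<in> pixel_values b" "I' i \<in> pixel_values b"
      using I by (auto simp: images_def)
    then obtain x y :: nat where xy: "I i = real x / q" "I' i = real y / q"
      by (auto simp: pixel_values_eq q_def)
    define t where "t = nat \<bar>int x - int y\<bar>"
    have "q * \<bar>I i - I' i\<bar> = \<bar>real x - real y\<bar>"
      using q by (simp add: xy flip: diff_divide_distrib)
    also have "\<dots> = real t" by (simp add: t_def)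
    finally have qt: "q * \<bar>I i - I' i\<bar> = real t" .
    have "t \<le> t ^ p" using p by (cases "t = 0") (auto intro: self_le_power)
    then have "q * \<bar>I i - I' i\<bar> \<le> (q * \<bar>I i - I' i\<bar>) ^ p"
      unfolding qt by (simp flip: of_nat_power)
    then show "q * \<bar>I i - I' i\<bar> \<le> q ^ p * \<bar>I i - I' i\<bar> ^ p"
      by (simp only: power_mult_distrib)
  qed
  then have "q * (\<Sum>i\<in>indices n h. \<bar>I i - I' i\<bar>) \<le> d"
    using qT by linarith
  moreover have "(\<Sum>i\<in>indices n h. \<bar>I i - I' i\<bar>) \<le> q * (\<Sum>i\<in>indices n h. \<bar>I i - I' i\<bar>)"
    using q mult_right_mono[of 1 q] by (simp add: sum_nonneg)
  ultimately show ?thesis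
    using brightness_diff_le[of n h I' I] by linarith
qed

text \<open>The norm enters only through \<open>close\<close>, so one argument serves every
  \<open>p\<close>: a dark image more than \<open>d\<close> below the threshold cannot be lifted to
  it, and the remaining dark images are few.\<close>

lemma dark_robust:
  assumes "n \<ge> 1" and "h \<ge> 1" and b: "b \<ge> 1" and c: "c > 0"
    and close: "\<And>I I'. I \<in> images n h b \<Longrightarrow> I' \<in> images n h b \<Longrightarrow>
       tensor_norm n h p (\<lambda>i. I i - I' i) \<le> \<delta> \<Longrightarrow>
       brightness n h I' - brightness n h I \<le> c * sqrt (real h) * real n - 2"
  shows "robust_class n h b (brightness_classifier n h) (1 - 4 * c) p \<delta> (dark n h b)"
proof -
  define d where "d = c * sqrt (real (n\<^sup>2 * h)) - 2"
  have d: "c * sqrt (real h) * real n - 2 = d"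
    by (simp add: d_def real_sqrt_mult)
  let ?R = "{I \<in> dark n h b. robust_image n h b (brightness_classifier n h) p \<delta> I}"
  let ?N = "{I \<in> dark n h b. real (n\<^sup>2 * h) / 2 - d \<le> brightness n h I}"
  have "(1 - 4 * c) * real (card (dark n h b)) \<le> real (card ?R)"
  proof (cases "c \<le> 1 / 4")
    case False
    \<comment> \<open>For \<open>c\<close> above 1/4 the required fraction is negative.\<close>
    then have "(1 - 4 * c) * real (card (dark n h b)) \<le> 0"
      by (intro mult_nonpos_nonneg) auto
    then show ?thesis by linarith
  next
    case True
    have "dark n h b \<subseteq> ?R \<union> ?N"
    proof (rule subsetI, rule ccontr)
      fix I assume I: "I \<in> dark n h b" and not: "I \<notin> ?R \<union> ?N"
      then obtain I' where I': "I' \<in> images n h b" "tensor_norm n h p (\<lambda>i. I i - I' i) \<le> \<delta>"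
        and ne: "brightness_classifier n h I \<noteq> brightness_classifier n h I'"
        by (auto simp: robust_image_def)
      \<comment> \<open>A changed label means that \<open>I'\<close> reaches the threshold, so
        \<open>I\<close> is at most \<open>d\<close> below it and belongs to
        \<open>?N\<close>.\<close>
      have "brightness n h I' - brightness n h I \<le> d"
        using close[of I I'] I I' d by (simp add: dark_def)
      moreover have "brightness n h I' \<ge> real (n\<^sup>2 * h) / 2"
        using I ne by (auto simp: dark_def brightness_classifier_eq split: if_splits)
      ultimately show False
        using I not by auto
    qed
    then have "card (dark n h b) \<le> card (?R \<union> ?N)"
      by (rule card_mono[rotated]) (simp add: finite_dark)
    also have "\<dots> \<le> card ?R + card ?N"
      by (rule card_Un_le)
    finally show ?thesis
      using card_below_threshold_le[OF b c True d_def] by (simp add: algebra_simps)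
  qed
  then show ?thesis
    using dark_nonempty[OF assms(1,2)] by (simp add: robust_class_def)
qed

theorem theorem2:
  fixes n h b :: nat
  assumes "n \<ge> 1" and "h \<ge> 1" and "b \<ge> 1"
  shows "\<exists>C \<in> induced_classes n h b {0, 1} (brightness_classifier n h).
           interesting n h b C \<and>
           (\<forall>c::real. c > 0 \<longrightarrow>
              (\<forall>p::nat. p \<le> 1 \<longrightarrow>
                 robust_class n h b (brightness_classifier n h) (1 - 4 * c) p
                   (c * sqrt (real h) * real n - 2) C) \<and>
              (\<forall>p::nat. p \<ge> 2 \<longrightarrow>
                 robust_class n h b (brightness_classifier n h) (1 - 4 * c) p
                   (root p (c * sqrt (real h) * real n - 2) / (2 ^ b - 1)) C))"
proof (intro bexI conjI allI impI)
  show "dark n h b \<in> induced_classes n h b {0, 1} (brightness_classifier n h)"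
    by (rule dark_induced)
  show "interesting n h b (dark n h b)"
    using assms by (rule dark_interesting)
  fix c :: real and p :: nat
  assume c: "c > 0"
  show "robust_class n h b (brightness_classifier n h) (1 - 4 * c) p
          (c * sqrt (real h) * real n - 2) (dark n h b)" if "p \<le> 1"
    using assms c by (rule dark_robust) (rule brightness_diff_le_norm_01[OF assms(3) _ _ that])
  show "robust_class n h b (brightness_classifier n h) (1 - 4 * c) p
          (root p (c * sqrt (real h) * real n - 2) / (2 ^ b - 1)) (dark n h b)" if "p \<ge> 2"
    using assms c by (rule dark_robust) (rule brightness_diff_le_norm_ge2[OF assms(3) _ _ that])
qed

end
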